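(* Let $n\ge 1$, let $\Omega$ be a finite subset of $\mathbb{Z}^n$, and let $\lambda_i$ be the $i$-th eigenvalue of the Dirichlet Laplacian on $\Omega$. Then for any $1\leq k\leq \sharp\Omega-1$, $$\lambda_{k+1}-\lambda_{k}\leq \frac{4}{n}\,\frac{\sum_{i=1}^k\lambda_i}{\sum_{i=1}^k(1-\lambda_i)},$$ where the right-hand side is to be interpreted as $+\infty$ if $\sum_{i=1}^k(1-\lambda_i)=0$.
   Context: $\mathbb{Z}^n$ denotes the integer lattice graph: vertex set $\mathbb{Z}^n$, with $x\sim y$ (neighbors) iff $\sum_{i=1}^n|x_i-y_i|=1$; every vertex has degree $d_x=2n$. The discrete Laplacian is $\Delta f(x)=\frac{1}{d_x}\sum_{y\sim x}f(y)-f(x)$ for $f:\mathbb{Z}^n\to\mathbb{R}$. For a finite subset $\Omega\subset\mathbb{Z}^n$ and $f:\Omega\to\mathbb{R}$, the Dirichlet Laplacian is $\Delta_\Omega f(x)=\Delta\widetilde f(x)$ for $x\in\Omega$, where $\widetilde f$ is the extension of $f$ by $0$ to $\mathbb{Z}^n$. It is self-adjoint on functions on $\Omega$ with inner product $\langle f,g\rangle=\sum_{x\in\Omega}f(x)g(x)d_x$. The eigenvalues of the Dirichlet Laplacian on $\Omega$ are the eigenvalues of $-\Delta_\Omega$, listed in non-decreasing order with multiplicity: $0<\lambda_1\le\lambda_2\le\cdots\le\lambda_N\le 2$, where $N=\sharp\Omega$ is the number of vertices of $\Omega$. *)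

theory Defs
  imports "HOL-Analysis.Analysis" "HOL-Library.Function_Algebras"
begin

text \<open>
  The lattice of dimension \<open>n\<close> is the type \<open>int ^ 'n\<close> with \<open>n = CARD('n)\<close>; since types are
  nonempty, this covers exactly the dimensions \<open>n \<ge> 1\<close>.
\<close>

definition lattice_nbrs :: "int ^ 'n::finite \<Rightarrow> (int ^ 'n) set" where
  "lattice_nbrs x = {y. (\<Sum>i\<in>UNIV. \<bar>x $ i - y $ i\<bar>) = 1}"

definition lattice_degree :: "int ^ 'n::finite \<Rightarrow> nat" where
  "lattice_degree x = card (lattice_nbrs x)"

definition lattice_laplacian :: "(int ^ 'n::finite \<Rightarrow> real) \<Rightarrow> int ^ 'n \<Rightarrow> real" where
  "lattice_laplacian f x =
     1 / real (lattice_degree x) * (\<Sum>y\<in>lattice_nbrs x. f y) - f x"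

text \<open>
  HOL functions are total, so a function on \<open>\<Omega>\<close> is represented by its extension by zero:
  \<open>functions_on \<Omega>\<close> is the space of all real functions on \<open>\<Omega>\<close>, a subspace of the functions
  on the lattice with the pointwise operations.
\<close>

definition extend_zero :: "'a set \<Rightarrow> ('a \<Rightarrow> real) \<Rightarrow> 'a \<Rightarrow> real" where
  "extend_zero \<Omega> f = (\<lambda>x. if x \<in> \<Omega> then f x else 0)"

definition functions_on :: "'a set \<Rightarrow> ('a \<Rightarrow> real) set" where
  "functions_on \<Omega> = {f. \<forall>x. x \<notin> \<Omega> \<longrightarrow> f x = 0}"

definition dirichlet_laplacian ::
    "(int ^ 'n::finite) set \<Rightarrow> (int ^ 'n \<Rightarrow> real) \<Rightarrow> int ^ 'n \<Rightarrow> real" where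
  "dirichlet_laplacian \<Omega> f = extend_zero \<Omega> (lattice_laplacian (extend_zero \<Omega> f))"

global_interpretation fun_space: vector_space "\<lambda>(c::real) (f :: 'a \<Rightarrow> real) x. c * f x"
  by unfold_locales (auto simp: plus_fun_def algebra_simps)

definition dirichlet_eigenspace ::
    "(int ^ 'n::finite) set \<Rightarrow> real \<Rightarrow> (int ^ 'n \<Rightarrow> real) set" where
  "dirichlet_eigenspace \<Omega> \<mu> =
     {f \<in> functions_on \<Omega>. \<forall>x\<in>\<Omega>. - dirichlet_laplacian \<Omega> f x = \<mu> * f x}"

definition dirichlet_eigenvalues :: "(int ^ 'n::finite) set \<Rightarrow> real set" where
  "dirichlet_eigenvalues \<Omega> = {\<mu>. \<exists>f\<in>dirichlet_eigenspace \<Omega> \<mu>. f \<noteq> (\<lambda>x. 0)}"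

text \<open>
  For finite \<open>\<Omega>\<close> the operator is self-adjoint, so geometric and algebraic multiplicities agree
  and the list below has length \<open>card \<Omega>\<close>.
\<close>

definition dirichlet_spectrum :: "(int ^ 'n::finite) set \<Rightarrow> real list" where
  "dirichlet_spectrum \<Omega> =
     concat (map (\<lambda>\<mu>. replicate (fun_space.dim (dirichlet_eigenspace \<Omega> \<mu>)) \<mu>)
       (sorted_list_of_set (dirichlet_eigenvalues \<Omega>)))"

text \<open>The \<open>i\<close>-th eigenvalue, counted from \<open>i = 1\<close>; meaningful for \<open>1 \<le> i \<le> card \<Omega>\<close>.\<close>

definition dirichlet_eigenvalue :: "(int ^ 'n::finite) set \<Rightarrow> nat \<Rightarrow> real" where
  "dirichlet_eigenvalue \<Omega> i = dirichlet_spectrum \<Omega> ! (i - 1)"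

end

theory Submission
  imports Defs
begin

text \<open>Let \<open>u\<^sub>i\<close> be an orthonormal eigenbasis with nondecreasing eigenvalues \<open>\<mu>\<^sub>i\<close> of
  \<open>T = - \<Delta>\<close> and let \<open>g\<close> be a coordinate function. By Parseval,
  \<open>\<langle>[T, g] u\<^sub>i, g u\<^sub>i\<rangle> = \<Sum>\<^sub>j (\<mu>\<^sub>j - \<mu>\<^sub>i) \<langle>g u\<^sub>i, u\<^sub>j\<rangle>\<^sup>2\<close> and
  \<open>\<parallel>[T, g] u\<^sub>i\<parallel>\<^sup>2 = \<Sum>\<^sub>j (\<mu>\<^sub>j - \<mu>\<^sub>i)\<^sup>2 \<langle>g u\<^sub>i, u\<^sub>j\<rangle>\<^sup>2\<close>. Summed over the first \<open>k\<close>
  indices \<open>i\<close>, the first sum times the gap after the \<open>k\<close>-th eigenvalue is at most the second.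
  On the lattice \<open>[T, g]\<close> is a difference of two translations; summed over the \<open>n\<close>
  coordinates, the left-hand sides become \<open>(1 - \<mu>\<^sub>i) / 2\<close> and at most \<open>2 \<mu>\<^sub>i / n\<close>.\<close>

subsection \<open>Symmetric kernels on a finite set\<close>

text \<open>The weight d_x is left out: it is the constant 2n on the lattice, so it affects neither
  orthogonality nor eigenvalues.\<close>

definition inner_on :: "'a set \<Rightarrow> ('a \<Rightarrow> real) \<Rightarrow> ('a \<Rightarrow> real) \<Rightarrow> real" where
  "inner_on \<Omega> f g = (\<Sum>x\<in>\<Omega>. f x * g x)"

definition kernel_op :: "'a set \<Rightarrow> ('a \<Rightarrow> 'a \<Rightarrow> real) \<Rightarrow> ('a \<Rightarrow> real) \<Rightarrow> 'a \<Rightarrow> real" where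
  "kernel_op \<Omega> A f x = (\<Sum>y\<in>\<Omega>. A x y * f y)"

definition orthonormal_on :: "'a set \<Rightarrow> (nat \<Rightarrow> 'a \<Rightarrow> real) \<Rightarrow> nat \<Rightarrow> bool" where
  "orthonormal_on \<Omega> u m \<longleftrightarrow>
     (\<forall>i<m. u i \<in> functions_on \<Omega>) \<and>
     (\<forall>i<m. \<forall>j<m. inner_on \<Omega> (u i) (u j) = (if i = j then 1 else 0))"

text \<open>The eigenvalue equation is asked on \<Omega> only, because \<open>kernel_op\<close> need
  not vanish elsewhere. The length m may stay below the dimension, so that a basis can be built one
  vector at a time.\<close>

definition eigenbasis_on ::
    "'a set \<Rightarrow> ('a \<Rightarrow> 'a \<Rightarrow> real) \<Rightarrow> (nat \<Rightarrow> 'a \<Rightarrow> real) \<Rightarrow> (nat \<Rightarrow> real) \<Rightarrow> nat \<Rightarrow> bool" where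
  "eigenbasis_on \<Omega> A u \<mu> m \<longleftrightarrow> orthonormal_on \<Omega> u m \<and>
     (\<forall>i<m. \<forall>x\<in>\<Omega>. kernel_op \<Omega> A (u i) x = \<mu> i * u i x)"

lemma inner_on_commute: "inner_on \<Omega> f g = inner_on \<Omega> g f"
  by (simp add: inner_on_def mult.commute)

lemma inner_on_add_left: "inner_on \<Omega> (\<lambda>x. f x + g x) h = inner_on \<Omega> f h + inner_on \<Omega> g h"
  by (simp add: inner_on_def sum.distrib algebra_simps)

lemma inner_on_diff_left: "inner_on \<Omega> (\<lambda>x. f x - g x) h = inner_on \<Omega> f h - inner_on \<Omega> g h"
  by (simp add: inner_on_def sum_subtractf algebra_simps)

lemma inner_on_scale_left: "inner_on \<Omega> (\<lambda>x. c * f x) h = c * inner_on \<Omega> f h"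
  by (simp add: inner_on_def sum_distrib_left algebra_simps)

lemma inner_on_add_right: "inner_on \<Omega> h (\<lambda>x. f x + g x) = inner_on \<Omega> h f + inner_on \<Omega> h g"
  by (simp add: inner_on_def sum.distrib algebra_simps)

lemma inner_on_scale_right: "inner_on \<Omega> h (\<lambda>x. c * f x) = c * inner_on \<Omega> h f"
  by (simp add: inner_on_def sum_distrib_left algebra_simps)

lemma inner_on_sum_left:
  "inner_on \<Omega> (\<lambda>x. \<Sum>j\<in>J. f j x) h = (\<Sum>j\<in>J. inner_on \<Omega> (f j) h)"
  unfolding inner_on_def sum_distrib_right by (rule sum.swap)

lemma inner_on_cong:
  "(\<And>x. x \<in> \<Omega> \<Longrightarrow> f x = f' x) \<Longrightarrow> (\<And>x. x \<in> \<Omega> \<Longrightarrow> g x = g' x) \<Longrightarrow>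
    inner_on \<Omega> f g = inner_on \<Omega> f' g'"
  by (simp add: inner_on_def)

lemma inner_on_self_nonneg: "0 \<le> inner_on \<Omega> f f"
  by (simp add: inner_on_def sum_nonneg)

lemma inner_on_self_eq_0:
  assumes "finite \<Omega>" "inner_on \<Omega> f f = 0" "x \<in> \<Omega>"
  shows "f x = 0"
proof -
  have "\<forall>x\<in>\<Omega>. f x * f x = 0"
    using assms(1,2) by (subst (asm) inner_on_def, subst (asm) sum_nonneg_eq_0_iff) auto
  thus ?thesis using assms(3) by auto
qed

lemma inner_on_delta_right:
  assumes "finite \<Omega>" "x \<in> \<Omega>"
  shows "inner_on \<Omega> f (\<lambda>y. if y = x then 1 else 0) = f x"
  using assms by (simp add: inner_on_def if_distrib cong: if_cong)

lemma kernel_op_symmetric: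
  assumes "\<forall>x y. A x y = A y x"
  shows "inner_on \<Omega> (kernel_op \<Omega> A f) g = inner_on \<Omega> f (kernel_op \<Omega> A g)"
proof -
  have "inner_on \<Omega> (kernel_op \<Omega> A f) g = (\<Sum>x\<in>\<Omega>. \<Sum>y\<in>\<Omega>. A x y * f y * g x)"
    by (simp add: inner_on_def kernel_op_def sum_distrib_right)
  also have "\<dots> = (\<Sum>y\<in>\<Omega>. \<Sum>x\<in>\<Omega>. A x y * f y * g x)" by (rule sum.swap)
  also have "\<dots> = inner_on \<Omega> f (kernel_op \<Omega> A g)"
    by (auto simp: inner_on_def kernel_op_def sum_distrib_left intro!: sum.cong)
       (use assms in \<open>simp add: mult_ac\<close>)
  finally show ?thesis .
qed

lemma kernel_op_add: "kernel_op \<Omega> A (\<lambda>x. f x + g x) = (\<lambda>x. kernel_op \<Omega> A f x + kernel_op \<Omega> A g x)"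
  by (simp add: kernel_op_def sum.distrib algebra_simps fun_eq_iff)

lemma kernel_op_scale: "kernel_op \<Omega> A (\<lambda>x. c * f x) = (\<lambda>x. c * kernel_op \<Omega> A f x)"
  by (simp add: kernel_op_def sum_distrib_left algebra_simps fun_eq_iff)

section \<open>Completeness of orthonormal systems\<close>

text \<open>The function r is the point mass at x minus its orthogonal projection onto the span of
  the \<open>u j\<close>; the Fourier coefficients of the point mass are the values
  \<open>u j x\<close>.\<close>

lemma orthonormal_on_residual:
  assumes fin: "finite \<Omega>" and on: "orthonormal_on \<Omega> u m" and x: "x \<in> \<Omega>"
  obtains r where "r \<in> functions_on \<Omega>" "\<And>i. i < m \<Longrightarrow> inner_on \<Omega> r (u i) = 0"
    "inner_on \<Omega> r r = 1 - (\<Sum>j<m. (u j x)\<^sup>2)"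
    "\<And>y. r y = (if y = x then 1 else 0) - (\<Sum>j<m. u j x * u j y)"
proof -
  define r where "r = (\<lambda>y. (if y = x then 1 else 0) - (\<Sum>j<m. u j x * u j y))"
  have ip: "inner_on \<Omega> r h = h x - (\<Sum>j<m. u j x * inner_on \<Omega> (u j) h)" for h
    unfolding r_def inner_on_diff_left inner_on_sum_left inner_on_scale_left
    using inner_on_delta_right[OF fin x, of h] by (simp add: inner_on_commute)
  have orth: "inner_on \<Omega> r (u i) = 0" if "i < m" for i
  proof -
    have "(\<Sum>j<m. u j x * inner_on \<Omega> (u j) (u i)) = (\<Sum>j<m. if j = i then u j x else 0)"
      using on that by (intro sum.cong) (auto simp: orthonormal_on_def)
    thus ?thesis using that by (simp add: ip)
  qed
  \<comment> \<open>In \<open>ip\<close> with h = r every Fourier term vanishes by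
    \<open>orth\<close>.\<close>
  have "inner_on \<Omega> r r = r x"
    unfolding ip[of r] using orth by (simp add: inner_on_commute)
  hence "inner_on \<Omega> r r = 1 - (\<Sum>j<m. (u j x)\<^sup>2)" by (simp add: r_def power2_eq_square)
  moreover have "r \<in> functions_on \<Omega>"
    using on x by (auto simp: functions_on_def r_def orthonormal_on_def)
  ultimately show ?thesis using that orth by (simp add: r_def)
qed

lemma orthonormal_on_sum_squares:
  assumes "orthonormal_on \<Omega> u m"
  shows "(\<Sum>x\<in>\<Omega>. \<Sum>j<m. (u j x)\<^sup>2) = real m"
proof -
  have "(\<Sum>x\<in>\<Omega>. \<Sum>j<m. (u j x)\<^sup>2) = (\<Sum>j<m. inner_on \<Omega> (u j) (u j))"
    unfolding inner_on_def by (subst sum.swap) (simp add: power2_eq_square)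
  also have "\<dots> = (\<Sum>j<m. 1)" using assms by (intro sum.cong) (auto simp: orthonormal_on_def)
  finally show ?thesis by simp
qed

text \<open>Counting replaces a dimension argument: the squared projections of the point masses add
  up to m < \<open>card \<Omega>\<close>, so some point mass lies outside the span and its residual
  can be normalised.\<close>

lemma exists_unit_orthogonal:
  assumes fin: "finite \<Omega>" and on: "orthonormal_on \<Omega> u m" and m: "m < card \<Omega>"
  obtains r where "r \<in> functions_on \<Omega>" "\<And>i. i < m \<Longrightarrow> inner_on \<Omega> r (u i) = 0"
    "inner_on \<Omega> r r = 1"
proof -
  have "\<exists>x\<in>\<Omega>. (\<Sum>j<m. (u j x)\<^sup>2) \<noteq> 1"
  proof (rule ccontr)
    assume "\<not> ?thesis"
    hence "(\<Sum>x\<in>\<Omega>. \<Sum>j<m. (u j x)\<^sup>2) = (\<Sum>x\<in>\<Omega>. 1)" by (intro sum.cong) auto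
    thus False using orthonormal_on_sum_squares[OF on] m by simp
  qed
  then obtain x where x: "x \<in> \<Omega>" "(\<Sum>j<m. (u j x)\<^sup>2) \<noteq> 1" by auto
  obtain r where r: "r \<in> functions_on \<Omega>" "\<And>i. i < m \<Longrightarrow> inner_on \<Omega> r (u i) = 0"
    "inner_on \<Omega> r r = 1 - (\<Sum>j<m. (u j x)\<^sup>2)"
    using orthonormal_on_residual[OF fin on x(1)] by metis
  define c where "c = 1 / sqrt (inner_on \<Omega> r r)"
  have pos: "inner_on \<Omega> r r > 0" using r(3) x(2) inner_on_self_nonneg[of \<Omega> r] by linarith
  show ?thesis
  proof (rule that[of "\<lambda>x. c * r x"])
    show "(\<lambda>x. c * r x) \<in> functions_on \<Omega>" using r(1) by (auto simp: functions_on_def)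
    show "inner_on \<Omega> (\<lambda>x. c * r x) (u i) = 0" if "i < m" for i
      using r(2)[OF that] by (simp add: inner_on_scale_left)
    have "inner_on \<Omega> (\<lambda>x. c * r x) (\<lambda>x. c * r x) = c\<^sup>2 * inner_on \<Omega> r r"
      by (simp add: inner_on_scale_left inner_on_scale_right power2_eq_square)
    also have "\<dots> = 1" using pos by (simp add: c_def power_divide)
    finally show "inner_on \<Omega> (\<lambda>x. c * r x) (\<lambda>x. c * r x) = 1" .
  qed
qed

text \<open>With \<open>card \<Omega>\<close> vectors the squared residuals of the point masses are
  nonnegative and add up to 0. Each residual is therefore zero, which is the resolution of the
  identity.\<close>

lemma orthonormal_on_complete:
  assumes fin: "finite \<Omega>" and on: "orthonormal_on \<Omega> u (card \<Omega>)" and x: "x \<in> \<Omega>" and y: "y \<in> \<Omega>"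
  shows "(\<Sum>j<card \<Omega>. u j x * u j y) = (if y = x then 1 else 0)"
proof -
  let ?m = "card \<Omega>"
  have le: "(\<Sum>j<?m. (u j z)\<^sup>2) \<le> 1" if "z \<in> \<Omega>" for z
    using orthonormal_on_residual[OF fin on that] inner_on_self_nonneg[of \<Omega>]
    by (metis diff_ge_0_iff_ge)
  have "(\<Sum>z\<in>\<Omega>. 1 - (\<Sum>j<?m. (u j z)\<^sup>2)) = 0"
    using orthonormal_on_sum_squares[OF on] by (simp add: sum_subtractf)
  hence "1 - (\<Sum>j<?m. (u j x)\<^sup>2) = 0"
    using sum_nonneg_eq_0_iff[OF fin, of "\<lambda>z. 1 - (\<Sum>j<?m. (u j z)\<^sup>2)"] le x by auto
  moreover obtain r where "inner_on \<Omega> r r = 1 - (\<Sum>j<?m. (u j x)\<^sup>2)"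
    "\<And>y. r y = (if y = x then 1 else 0) - (\<Sum>j<?m. u j x * u j y)"
    using orthonormal_on_residual[OF fin on x] by metis
  ultimately show ?thesis using inner_on_self_eq_0[OF fin _ y, of r] by simp
qed

lemma orthonormal_on_expansion:
  assumes fin: "finite \<Omega>" and on: "orthonormal_on \<Omega> u (card \<Omega>)" and x: "x \<in> \<Omega>"
  shows "f x = (\<Sum>j<card \<Omega>. inner_on \<Omega> f (u j) * u j x)"
proof -
  have "(\<Sum>j<card \<Omega>. inner_on \<Omega> f (u j) * u j x)
      = (\<Sum>j<card \<Omega>. \<Sum>y\<in>\<Omega>. f y * (u j x * u j y))"
    unfolding inner_on_def sum_distrib_right by (simp add: mult_ac)
  also have "\<dots> = (\<Sum>y\<in>\<Omega>. \<Sum>j<card \<Omega>. f y * (u j x * u j y))" by (rule sum.swap)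
  also have "\<dots> = (\<Sum>y\<in>\<Omega>. f y * (if y = x then 1 else 0))"
    unfolding sum_distrib_left[symmetric]
    using orthonormal_on_complete[OF fin on x] by (intro sum.cong) auto
  also have "\<dots> = f x" using inner_on_delta_right[OF fin x, of f] by (simp add: inner_on_def)
  finally show ?thesis by simp
qed

lemma orthonormal_on_parseval:
  assumes fin: "finite \<Omega>" and on: "orthonormal_on \<Omega> u (card \<Omega>)"
  shows "inner_on \<Omega> f g = (\<Sum>j<card \<Omega>. inner_on \<Omega> f (u j) * inner_on \<Omega> g (u j))"
proof -
  have "inner_on \<Omega> f g = inner_on \<Omega> (\<lambda>x. \<Sum>j<card \<Omega>. inner_on \<Omega> f (u j) * u j x) g"
    using orthonormal_on_expansion[OF fin on] by (intro inner_on_cong) auto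
  thus ?thesis by (simp add: inner_on_sum_left inner_on_scale_left inner_on_commute)
qed

section \<open>Spectral theorem by successive minimisation\<close>

lemma compact_cube_functions_on:
  "compact {f \<in> functions_on \<Omega>. \<forall>x\<in>\<Omega>. f x \<in> {-1..1::real}}"
proof -
  \<comment> \<open>The factor {0} at points off \<Omega> turns the support condition into part of a
    product of compact sets, so Tychonoff applies.\<close>
  have eq: "{f \<in> functions_on \<Omega>. \<forall>x\<in>\<Omega>. f x \<in> {-1..1::real}}
    = PiE UNIV (\<lambda>x. if x \<in> \<Omega> then {-1..1} else {0})"
    by (auto simp: functions_on_def PiE_def Pi_def split: if_splits)
  have "compactin (product_topology (\<lambda>i::'a. euclidean) UNIV)
     (PiE UNIV (\<lambda>x. if x \<in> \<Omega> then {-1..1::real} else {0}))"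
    by (subst compactin_PiE) auto
  thus ?thesis unfolding eq euclidean_product_topology by simp
qed

lemma continuous_on_inner_on:
  assumes "\<And>x. x \<in> \<Omega> \<Longrightarrow> continuous_on S (\<lambda>f. F f x)" "\<And>x. x \<in> \<Omega> \<Longrightarrow> continuous_on S (\<lambda>f. G f x)"
  shows "continuous_on S (\<lambda>f. inner_on \<Omega> (F f) (G f))"
  unfolding inner_on_def by (intro continuous_on_sum continuous_on_mult assms)

lemma continuous_on_coordinate: "continuous_on S (\<lambda>f::'a \<Rightarrow> real. f x)"
  by (rule continuous_on_subset[OF continuous_on_product_coordinates]) simp

text \<open>A single square is at most the whole sum of squares, so the unit sphere lies in the
  cube; the remaining conditions are closed.\<close>

lemma compact_unit_sphere_orthogonal:
  assumes fin: "finite \<Omega>"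
  shows "compact {f \<in> functions_on \<Omega>. inner_on \<Omega> f f = 1 \<and> (\<forall>i<m. inner_on \<Omega> f (u i) = 0)}"
    (is "compact ?K")
proof -
  let ?C = "{f \<in> functions_on \<Omega>. \<forall>x\<in>\<Omega>. f x \<in> {-1..1::real}}"
  have "f x \<in> {-1..1}" if "inner_on \<Omega> f f = 1" "x \<in> \<Omega>" for f x
  proof -
    have "f x * f x \<le> inner_on \<Omega> f f"
      unfolding inner_on_def using fin that(2) by (intro member_le_sum) auto
    hence "(f x)\<^sup>2 \<le> 1" using that by (simp add: power2_eq_square)
    thus ?thesis using abs_square_le_1[of "f x"] by auto
  qed
  hence "?K = ?C \<inter> ({f. inner_on \<Omega> f f = 1} \<inter> (\<Inter>i\<in>{..<m}. {f. inner_on \<Omega> f (u i) = 0}))"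
    by auto
  moreover have "closed ({f. inner_on \<Omega> f f = 1} \<inter> (\<Inter>i\<in>{..<m}. {f. inner_on \<Omega> f (u i) = 0}))"
    by (intro closed_Int closed_INT ballI closed_Collect_eq continuous_on_inner_on
        continuous_on_const continuous_on_coordinate)
  ultimately show ?thesis by (simp only: compact_Int_closed[OF compact_cube_functions_on])
qed

text \<open>A minimiser of the quadratic form on the unit sphere orthogonal to earlier eigenvectors is
  an eigenvector: its defect \<open>w\<close> is an admissible direction, and the first variation along
  \<open>w\<close> is \<open>2 \<parallel>w\<parallel>\<^sup>2\<close>.\<close>

lemma eigenbasis_on_minimiser:
  assumes fin: "finite \<Omega>" and sym: "\<forall>x y. A x y = A y x"
    and eb: "eigenbasis_on \<Omega> A u \<mu> m" and m: "m < card \<Omega>"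
  obtains v where "v \<in> functions_on \<Omega>" "\<And>i. i < m \<Longrightarrow> inner_on \<Omega> v (u i) = 0"
    "inner_on \<Omega> v v = 1"
    "\<And>f. f \<in> functions_on \<Omega> \<Longrightarrow> (\<And>i. i < m \<Longrightarrow> inner_on \<Omega> f (u i) = 0) \<Longrightarrow> inner_on \<Omega> f f = 1 \<Longrightarrow>
       inner_on \<Omega> (kernel_op \<Omega> A v) v \<le> inner_on \<Omega> (kernel_op \<Omega> A f) f"
    "\<And>x. x \<in> \<Omega> \<Longrightarrow> kernel_op \<Omega> A v x = inner_on \<Omega> (kernel_op \<Omega> A v) v * v x"
proof -
  let ?T = "kernel_op \<Omega> A"
  let ?q = "\<lambda>f. inner_on \<Omega> (?T f) f"
  let ?K = "{f \<in> functions_on \<Omega>. inner_on \<Omega> f f = 1 \<and> (\<forall>i<m. inner_on \<Omega> f (u i) = 0)}"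
  have on: "orthonormal_on \<Omega> u m" using eb by (simp add: eigenbasis_on_def)
  have "?K \<noteq> {}"
  proof (rule exists_unit_orthogonal[OF fin on m])
    fix r assume "r \<in> functions_on \<Omega>" "\<And>i. i < m \<Longrightarrow> inner_on \<Omega> r (u i) = 0"
      "inner_on \<Omega> r r = 1"
    hence "r \<in> ?K" by simp
    thus "?K \<noteq> {}" by (metis empty_iff)
  qed
  moreover have "continuous_on ?K ?q"
    unfolding kernel_op_def
    by (intro continuous_on_inner_on continuous_on_sum continuous_on_mult continuous_on_const
        continuous_on_coordinate)
  ultimately have "\<exists>v\<in>?K. \<forall>f\<in>?K. ?q v \<le> ?q f"
    by (intro continuous_attains_inf compact_unit_sphere_orthogonal fin)
  then obtain v where v: "v \<in> ?K" and min: "\<And>f. f \<in> ?K \<Longrightarrow> ?q v \<le> ?q f" by blast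
  define w where "w = (\<lambda>x. if x \<in> \<Omega> then ?T v x - ?q v * v x else 0)"
  have ipw: "inner_on \<Omega> w h = inner_on \<Omega> (?T v) h - ?q v * inner_on \<Omega> v h" for h
  proof -
    have "inner_on \<Omega> w h = inner_on \<Omega> (\<lambda>x. ?T v x - ?q v * v x) h"
      by (intro inner_on_cong) (auto simp: w_def)
    thus ?thesis by (simp add: inner_on_diff_left inner_on_scale_left)
  qed
  have wu: "inner_on \<Omega> w (u i) = 0" if "i < m" for i
  proof -
    have "inner_on \<Omega> (?T v) (u i) = inner_on \<Omega> v (?T (u i))" by (rule kernel_op_symmetric[OF sym])
    also have "\<dots> = inner_on \<Omega> v (\<lambda>x. \<mu> i * u i x)"
      using eb that by (intro inner_on_cong) (auto simp: eigenbasis_on_def)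
    also have "\<dots> = 0" using v that by (simp add: inner_on_scale_right)
    finally show ?thesis using v that by (simp add: ipw)
  qed
  have wv: "inner_on \<Omega> w v = 0" using v by (simp add: ipw)
  \<comment> \<open>Minimality of v is tested on v + t w after normalisation. Multiplying by the
    squared norm of v + t w leaves a quadratic polynomial in t without constant term.\<close>
  have ineq: "0 \<le> 2 * t * inner_on \<Omega> w w + t\<^sup>2 * (?q w - ?q v * inner_on \<Omega> w w)" for t
  proof -
    define f where "f = (\<lambda>x. v x + t * w x)"
    have nf: "inner_on \<Omega> f f = 1 + t\<^sup>2 * inner_on \<Omega> w w"
      using v wv by (simp add: f_def inner_on_add_left inner_on_add_right inner_on_scale_left
          inner_on_scale_right inner_on_commute[of \<Omega> v w] power2_eq_square)
    have "?q f = ?q v + t * inner_on \<Omega> (?T v) w + t * inner_on \<Omega> (?T w) v + t\<^sup>2 * ?q w"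
      by (simp add: f_def kernel_op_add kernel_op_scale inner_on_add_left inner_on_add_right
          inner_on_scale_left inner_on_scale_right power2_eq_square algebra_simps)
    moreover have "inner_on \<Omega> (?T w) v = inner_on \<Omega> (?T v) w"
      by (rule trans[OF kernel_op_symmetric[OF sym] inner_on_commute])
    moreover have "inner_on \<Omega> (?T v) w = inner_on \<Omega> w w"
      using ipw[of w] wv by (simp add: inner_on_commute)
    ultimately have qf: "?q f = ?q v + 2 * t * inner_on \<Omega> w w + t\<^sup>2 * ?q w" by simp
    define c where "c = 1 / sqrt (inner_on \<Omega> f f)"
    have pos: "inner_on \<Omega> f f > 0"
      unfolding nf using inner_on_self_nonneg[of \<Omega> w] by (simp add: add_pos_nonneg)
    hence c2: "c\<^sup>2 * inner_on \<Omega> f f = 1" by (simp add: c_def power_divide)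
    have "(\<lambda>x. c * f x) \<in> ?K"
    proof -
      have "inner_on \<Omega> (\<lambda>x. c * f x) (\<lambda>x. c * f x) = 1"
        using c2 by (simp add: inner_on_scale_left inner_on_scale_right power2_eq_square mult_ac)
      moreover have "inner_on \<Omega> (\<lambda>x. c * f x) (u i) = 0" if "i < m" for i
        using v wu[OF that] that by (simp add: f_def inner_on_scale_left inner_on_add_left)
      moreover have "(\<lambda>x. c * f x) \<in> functions_on \<Omega>"
        using v by (auto simp: functions_on_def f_def w_def)
      ultimately show ?thesis by auto
    qed
    hence "?q v \<le> ?q (\<lambda>x. c * f x)" by (rule min)
    also have "\<dots> = c\<^sup>2 * ?q f"
      by (simp add: kernel_op_scale inner_on_scale_left inner_on_scale_right power2_eq_square)
    finally have "?q v * inner_on \<Omega> f f \<le> (c\<^sup>2 * ?q f) * inner_on \<Omega> f f"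
      using pos by (simp add: mult_right_mono)
    also have "\<dots> = (c\<^sup>2 * inner_on \<Omega> f f) * ?q f" by (simp add: mult_ac)
    finally have "?q v * inner_on \<Omega> f f \<le> ?q f" unfolding c2 by simp
    thus ?thesis unfolding nf qf by (simp add: algebra_simps)
  qed
  have "inner_on \<Omega> w w = 0"
  proof (rule ccontr)
    define a where "a = inner_on \<Omega> w w"
    define b where "b = ?q w - ?q v * a"
    assume "inner_on \<Omega> w w \<noteq> 0"
    hence a: "a > 0" using inner_on_self_nonneg[of \<Omega> w] by (simp add: a_def)
    \<comment> \<open>The bound d is positive whatever the sign of b, and t = -a/d is the minimiser
      of 2ta + t^2 d, with value -a^2/d < 0.\<close>
    define d where "d = \<bar>b\<bar> + 1"
    have d: "d > 0" "b \<le> d" by (auto simp: d_def)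
    define t where "t = - a / d"
    have "0 \<le> 2 * t * a + t\<^sup>2 * b" using ineq[of t] by (simp add: a_def b_def)
    also have "\<dots> \<le> 2 * t * a + t\<^sup>2 * d" using d by (intro add_left_mono mult_left_mono) auto
    also have "\<dots> = - (a\<^sup>2 / d)" using d by (simp add: t_def field_simps power2_eq_square)
    also have "\<dots> < 0" using a d by simp
    finally show False by simp
  qed
  hence eig: "?T v x = ?q v * v x" if "x \<in> \<Omega>" for x
    using inner_on_self_eq_0[OF fin _ that, of w] that by (simp add: w_def)
  show ?thesis
  proof (rule that[of v])
    show "v \<in> functions_on \<Omega>" "\<And>i. i < m \<Longrightarrow> inner_on \<Omega> v (u i) = 0" "inner_on \<Omega> v v = 1"
      using v by auto
    show "?q v \<le> ?q f" if "f \<in> functions_on \<Omega>" "\<And>i. i < m \<Longrightarrow> inner_on \<Omega> f (u i) = 0"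
      "inner_on \<Omega> f f = 1" for f
      by (rule min) (use that in simp)
  qed (rule eig)
qed

text \<open>The minimum property is carried through the induction because it yields the ordering of
  the eigenvalues.\<close>

lemma eigenbasis_on_exists_partial:
  assumes fin: "finite \<Omega>" and sym: "\<forall>x y. A x y = A y x"
  shows "m \<le> card \<Omega> \<Longrightarrow> \<exists>u \<mu>. eigenbasis_on \<Omega> A u \<mu> m \<and> (\<forall>i<m. \<forall>j<i. \<mu> j \<le> \<mu> i) \<and>
    (\<forall>i<m. \<forall>f\<in>functions_on \<Omega>. (\<forall>j<i. inner_on \<Omega> f (u j) = 0) \<longrightarrow> inner_on \<Omega> f f = 1 \<longrightarrow>
       \<mu> i \<le> inner_on \<Omega> (kernel_op \<Omega> A f) f)"
proof (induction m)
  case 0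
  show ?case by (simp add: eigenbasis_on_def orthonormal_on_def)
next
  case (Suc m)
  then obtain u \<mu> where eb: "eigenbasis_on \<Omega> A u \<mu> m" and mono: "\<forall>i<m. \<forall>j<i. \<mu> j \<le> \<mu> i"
    and min: "\<forall>i<m. \<forall>f\<in>functions_on \<Omega>. (\<forall>j<i. inner_on \<Omega> f (u j) = 0) \<longrightarrow> inner_on \<Omega> f f = 1 \<longrightarrow>
       \<mu> i \<le> inner_on \<Omega> (kernel_op \<Omega> A f) f" by auto
  from Suc.prems have m: "m < card \<Omega>" by simp
  obtain v where v: "v \<in> functions_on \<Omega>" "\<And>i. i < m \<Longrightarrow> inner_on \<Omega> v (u i) = 0"
    "inner_on \<Omega> v v = 1"
    "\<And>f. f \<in> functions_on \<Omega> \<Longrightarrow> (\<And>i. i < m \<Longrightarrow> inner_on \<Omega> f (u i) = 0) \<Longrightarrow> inner_on \<Omega> f f = 1 \<Longrightarrow>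
       inner_on \<Omega> (kernel_op \<Omega> A v) v \<le> inner_on \<Omega> (kernel_op \<Omega> A f) f"
    "\<And>x. x \<in> \<Omega> \<Longrightarrow> kernel_op \<Omega> A v x = inner_on \<Omega> (kernel_op \<Omega> A v) v * v x"
    using eigenbasis_on_minimiser[OF fin sym eb m] by metis
  define l where "l = inner_on \<Omega> (kernel_op \<Omega> A v) v"
  \<comment> \<open>The new vector is orthogonal to all earlier ones, hence it was admissible when
    \<open>u i\<close> was chosen as a minimiser.\<close>
  have ge: "\<mu> i \<le> l" if "i < m" for i
    using min v(1,2,3) that by (auto simp: l_def)
  define u' where "u' = u(m := v)"
  define \<mu>' where "\<mu>' = \<mu>(m := l)"
  have "inner_on \<Omega> (u i) v = 0" if "i < m" for i
    using v(2)[OF that] by (simp add: inner_on_commute)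
  hence "eigenbasis_on \<Omega> A u' \<mu>' (Suc m)"
    using eb v(1,2,3,5) unfolding eigenbasis_on_def orthonormal_on_def u'_def \<mu>'_def l_def
    by (auto simp: less_Suc_eq)
  moreover have "\<forall>i<Suc m. \<forall>j<i. \<mu>' j \<le> \<mu>' i"
    using mono ge by (auto simp: \<mu>'_def less_Suc_eq)
  moreover have "\<forall>i<Suc m. \<forall>f\<in>functions_on \<Omega>. (\<forall>j<i. inner_on \<Omega> f (u' j) = 0) \<longrightarrow>
      inner_on \<Omega> f f = 1 \<longrightarrow> \<mu>' i \<le> inner_on \<Omega> (kernel_op \<Omega> A f) f"
  proof (intro allI ballI impI)
    fix i f assume i: "i < Suc m" and f: "f \<in> functions_on \<Omega>" "inner_on \<Omega> f f = 1"
      and o: "\<forall>j<i. inner_on \<Omega> f (u' j) = 0"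
    have o': "\<forall>j<i. inner_on \<Omega> f (u j) = 0" using o i by (auto simp: u'_def split: if_splits)
    show "\<mu>' i \<le> inner_on \<Omega> (kernel_op \<Omega> A f) f"
      using min v(4)[OF f(1)] o' f i by (auto simp: \<mu>'_def l_def less_Suc_eq)
  qed
  ultimately show ?case by blast
qed

lemma eigenbasis_on_exists:
  assumes "finite \<Omega>" "\<forall>x y. A x y = A y x"
  obtains u \<mu> where "eigenbasis_on \<Omega> A u \<mu> (card \<Omega>)" "\<forall>i<card \<Omega>. \<forall>j\<le>i. \<mu> j \<le> \<mu> i"
proof -
  obtain u \<mu> where "eigenbasis_on \<Omega> A u \<mu> (card \<Omega>)" and "\<forall>i<card \<Omega>. \<forall>j<i. \<mu> j \<le> \<mu> i"
    using eigenbasis_on_exists_partial[OF assms, of "card \<Omega>"] by blast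
  thus ?thesis using that by (metis le_neq_implies_less order_refl)
qed

section \<open>Commutators with multiplication operators, and the trace\<close>

text \<open>By symmetry the operator in the first term moves onto \<open>u j\<close> and produces
  \<open>\<mu> j\<close>; in the second term it acts on \<open>u i\<close> and produces
  \<open>\<mu> i\<close>.\<close>

lemma eigenbasis_on_commutator_coeff:
  assumes sym: "\<forall>x y. A x y = A y x" and eb: "eigenbasis_on \<Omega> A u \<mu> m" and ij: "i < m" "j < m"
  shows "inner_on \<Omega> (\<lambda>x. kernel_op \<Omega> A (\<lambda>y. g y * u i y) x - g x * kernel_op \<Omega> A (u i) x) (u j)
    = (\<mu> j - \<mu> i) * inner_on \<Omega> (\<lambda>x. g x * u i x) (u j)"
proof -
  have "inner_on \<Omega> (kernel_op \<Omega> A (\<lambda>y. g y * u i y)) (u j)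
      = inner_on \<Omega> (\<lambda>y. g y * u i y) (kernel_op \<Omega> A (u j))"
    by (rule kernel_op_symmetric[OF sym])
  also have "\<dots> = inner_on \<Omega> (\<lambda>y. g y * u i y) (\<lambda>x. \<mu> j * u j x)"
    using eb ij by (intro inner_on_cong) (auto simp: eigenbasis_on_def)
  finally have 1: "inner_on \<Omega> (kernel_op \<Omega> A (\<lambda>y. g y * u i y)) (u j)
      = \<mu> j * inner_on \<Omega> (\<lambda>y. g y * u i y) (u j)" by (simp add: inner_on_scale_right)
  have "inner_on \<Omega> (\<lambda>x. g x * kernel_op \<Omega> A (u i) x) (u j)
      = inner_on \<Omega> (\<lambda>x. \<mu> i * (g x * u i x)) (u j)"
    using eb ij by (intro inner_on_cong) (auto simp: eigenbasis_on_def)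
  thus ?thesis using 1 by (simp add: inner_on_diff_left inner_on_scale_left algebra_simps)
qed

text \<open>In the sum over \<open>i, j < k\<close> the terms \<open>(\<mu> j - \<mu> i) g\<^sub>i\<^sub>j\<^sup>2\<close> cancel by antisymmetry, so only
  \<open>j \<ge> k\<close> contributes, where \<open>\<mu> j - \<mu> i\<close> is at least the gap.\<close>

lemma commutator_gap_inequality:
  fixes g :: "'a \<Rightarrow> real"
  assumes fin: "finite \<Omega>" and sym: "\<forall>x y. A x y = A y x"
    and eb: "eigenbasis_on \<Omega> A u \<mu> (card \<Omega>)"
    and mono: "\<And>i j. j \<le> i \<Longrightarrow> i < card \<Omega> \<Longrightarrow> \<mu> j \<le> \<mu> i"
    and k: "1 \<le> k" "k < card \<Omega>"
  defines "C \<equiv> \<lambda>i x. kernel_op \<Omega> A (\<lambda>y. g y * u i y) x - g x * kernel_op \<Omega> A (u i) x"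
  shows "(\<mu> k - \<mu> (k - 1)) * (\<Sum>i<k. inner_on \<Omega> (C i) (\<lambda>x. g x * u i x))
    \<le> (\<Sum>i<k. inner_on \<Omega> (C i) (C i))"
proof -
  let ?N = "card \<Omega>"
  have on: "orthonormal_on \<Omega> u ?N" using eb by (simp add: eigenbasis_on_def)
  define a where "a = (\<lambda>i j. inner_on \<Omega> (\<lambda>x. g x * u i x) (u j))"
  \<comment> \<open>Multiplication by g is symmetric; the cancellation over i, j < k rests on
    this.\<close>
  have asym: "a i j = a j i" for i j by (simp add: a_def inner_on_def mult_ac)
  have Ca: "inner_on \<Omega> (C i) (u j) = (\<mu> j - \<mu> i) * a i j" if "i < ?N" "j < ?N" for i j
    unfolding C_def a_def by (rule eigenbasis_on_commutator_coeff[OF sym eb that])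
  have split: "{..<?N} = {..<k} \<union> {k..<?N}" "{..<k} \<inter> {k..<?N} = {}" using k by auto
  have "(\<Sum>i<k. inner_on \<Omega> (C i) (\<lambda>x. g x * u i x)) = (\<Sum>i<k. \<Sum>j<?N. (\<mu> j - \<mu> i) * (a i j)\<^sup>2)"
  proof (rule sum.cong[OF refl])
    fix i assume "i \<in> {..<k}"
    thus "inner_on \<Omega> (C i) (\<lambda>x. g x * u i x) = (\<Sum>j<?N. (\<mu> j - \<mu> i) * (a i j)\<^sup>2)"
      using k unfolding orthonormal_on_parseval[OF fin on, of "C i" "\<lambda>x. g x * u i x"]
      by (intro sum.cong) (auto simp: Ca a_def power2_eq_square)
  qed
  also have "\<dots> = (\<Sum>i<k. \<Sum>j<k. (\<mu> j - \<mu> i) * (a i j)\<^sup>2) + (\<Sum>i<k. \<Sum>j=k..<?N. (\<mu> j - \<mu> i) * (a i j)\<^sup>2)"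
    unfolding split(1) by (simp add: sum.union_disjoint[OF _ _ split(2)] sum.distrib)
  also have "(\<Sum>i<k. \<Sum>j<k. (\<mu> j - \<mu> i) * (a i j)\<^sup>2) = 0"
  proof -
    have "(\<Sum>i<k. \<Sum>j<k. (\<mu> j - \<mu> i) * (a i j)\<^sup>2) = (\<Sum>j<k. \<Sum>i<k. (\<mu> j - \<mu> i) * (a i j)\<^sup>2)"
      by (rule sum.swap)
    also have "\<dots> = - (\<Sum>j<k. \<Sum>i<k. (\<mu> i - \<mu> j) * (a j i)\<^sup>2)"
      unfolding sum_negf[symmetric] by (intro sum.cong refl) (simp add: asym algebra_simps)
    finally show ?thesis by simp
  qed
  finally have B: "(\<Sum>i<k. inner_on \<Omega> (C i) (\<lambda>x. g x * u i x))
      = (\<Sum>i<k. \<Sum>j=k..<?N. (\<mu> j - \<mu> i) * (a i j)\<^sup>2)" by simp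
  have "(\<mu> k - \<mu> (k - 1)) * (\<Sum>i<k. inner_on \<Omega> (C i) (\<lambda>x. g x * u i x))
      = (\<Sum>i<k. \<Sum>j=k..<?N. (\<mu> k - \<mu> (k - 1)) * ((\<mu> j - \<mu> i) * (a i j)\<^sup>2))"
    unfolding B by (simp add: sum_distrib_left)
  also have "\<dots> \<le> (\<Sum>i<k. \<Sum>j=k..<?N. (\<mu> j - \<mu> i) * ((\<mu> j - \<mu> i) * (a i j)\<^sup>2))"
  proof (intro sum_mono mult_right_mono)
    fix i j assume ij: "i \<in> {..<k}" "j \<in> {k..<?N}"
    have "\<mu> k \<le> \<mu> j" "\<mu> i \<le> \<mu> (k - 1)" "\<mu> i \<le> \<mu> j" using ij k by (auto intro!: mono)
    thus "\<mu> k - \<mu> (k - 1) \<le> \<mu> j - \<mu> i" "0 \<le> (\<mu> j - \<mu> i) * (a i j)\<^sup>2" by auto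
  qed
  \<comment> \<open>The terms with j < k are squares here, so they may be added back to complete the
    sum for Parseval.\<close>
  also have "\<dots> \<le> (\<Sum>i<k. \<Sum>j<?N. (\<mu> j - \<mu> i) * ((\<mu> j - \<mu> i) * (a i j)\<^sup>2))"
  proof (intro sum_mono sum_mono2)
    fix i j
    have "(\<mu> j - \<mu> i) * ((\<mu> j - \<mu> i) * (a i j)\<^sup>2) = ((\<mu> j - \<mu> i) * a i j)\<^sup>2"
      by (simp add: power2_eq_square)
    thus "0 \<le> (\<mu> j - \<mu> i) * ((\<mu> j - \<mu> i) * (a i j)\<^sup>2)" by simp
  qed auto
  also have "\<dots> = (\<Sum>i<k. inner_on \<Omega> (C i) (C i))"
  proof (rule sum.cong[OF refl])
    fix i assume "i \<in> {..<k}"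
    thus "(\<Sum>j<?N. (\<mu> j - \<mu> i) * ((\<mu> j - \<mu> i) * (a i j)\<^sup>2)) = inner_on \<Omega> (C i) (C i)"
      using k unfolding orthonormal_on_parseval[OF fin on, of "C i" "C i"]
      by (intro sum.cong) (auto simp: Ca power2_eq_square)
  qed
  finally show ?thesis .
qed

text \<open>Each \<open>\<mu> i\<close> is the quadratic form at \<open>u i\<close>; summing over i
  first, completeness reduces the double sum over the kernel to its diagonal.\<close>

lemma eigenbasis_on_trace:
  assumes fin: "finite \<Omega>" and eb: "eigenbasis_on \<Omega> A u \<mu> (card \<Omega>)"
  shows "(\<Sum>i<card \<Omega>. \<mu> i) = (\<Sum>x\<in>\<Omega>. A x x)"
proof -
  have on: "orthonormal_on \<Omega> u (card \<Omega>)" using eb by (simp add: eigenbasis_on_def)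
  have "(\<Sum>i<card \<Omega>. \<mu> i) = (\<Sum>i<card \<Omega>. \<Sum>x\<in>\<Omega>. kernel_op \<Omega> A (u i) x * u i x)"
  proof (rule sum.cong[OF refl])
    fix i assume i: "i \<in> {..<card \<Omega>}"
    have "(\<Sum>x\<in>\<Omega>. kernel_op \<Omega> A (u i) x * u i x) = inner_on \<Omega> (\<lambda>x. \<mu> i * u i x) (u i)"
      unfolding inner_on_def using eb i by (intro sum.cong) (auto simp: eigenbasis_on_def)
    also have "\<dots> = \<mu> i" using on i by (simp add: inner_on_scale_left orthonormal_on_def)
    finally show "\<mu> i = (\<Sum>x\<in>\<Omega>. kernel_op \<Omega> A (u i) x * u i x)" by simp
  qed
  also have "\<dots> = (\<Sum>x\<in>\<Omega>. \<Sum>i<card \<Omega>. \<Sum>y\<in>\<Omega>. A x y * (u i x * u i y))"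
    unfolding kernel_op_def sum_distrib_right by (subst sum.swap) (simp add: mult_ac)
  also have "\<dots> = (\<Sum>x\<in>\<Omega>. \<Sum>y\<in>\<Omega>. A x y * (\<Sum>i<card \<Omega>. u i x * u i y))"
    unfolding sum_distrib_left by (intro sum.cong refl sum.swap)
  also have "\<dots> = (\<Sum>x\<in>\<Omega>. \<Sum>y\<in>\<Omega>. A x y * (if y = x then 1 else 0))"
    using orthonormal_on_complete[OF fin on] by (intro sum.cong) auto
  also have "\<dots> = (\<Sum>x\<in>\<Omega>. A x x)"
    using inner_on_delta_right[OF fin] by (simp add: inner_on_def)
  finally show ?thesis .
qed

subsection \<open>Eigenvalues listed with multiplicity\<close>

lemma sum_fun_apply: "(\<Sum>i\<in>I. F i) x = (\<Sum>i\<in>I. F i x)"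
  by (induction I rule: infinite_finite_induct) auto

lemma inj_on_orthonormal:
  assumes "orthonormal_on \<Omega> u m"
  shows "inj_on u {..<m}"
proof (rule inj_onI)
  fix i j assume ij: "i \<in> {..<m}" "j \<in> {..<m}" and eq: "u i = u j"
  have "inner_on \<Omega> (u i) (u j) = (if i = j then 1 else 0)"
    using assms ij by (simp add: orthonormal_on_def)
  moreover have "inner_on \<Omega> (u i) (u j) = 1"
    unfolding eq using assms ij by (simp add: orthonormal_on_def)
  ultimately show "i = j" by (simp split: if_splits)
qed

text \<open>Pairing a vanishing combination with \<open>u i\<close> isolates the coefficient of
  \<open>u i\<close>.\<close>

lemma independent_orthonormal:
  assumes on: "orthonormal_on \<Omega> u m" and J: "J \<subseteq> {..<m}"
  shows "\<not> fun_space.dependent (u ` J)"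
proof
  have finJ: "finite J" using J finite_subset by blast
  assume "fun_space.dependent (u ` J)"
  then obtain c v where v: "v \<in> u ` J" "c v \<noteq> 0" and z: "(\<Sum>v\<in>u ` J. (\<lambda>x. c v * v x)) = 0"
    using fun_space.dependent_finite[of "u ` J"] finJ by auto
  from v(1) obtain i where i: "i \<in> J" "v = u i" by auto
  have inj: "inj_on u J" using inj_on_orthonormal[OF on] J inj_on_subset by blast
  have "0 = inner_on \<Omega> (\<lambda>x. (\<Sum>v\<in>u ` J. (\<lambda>x. c v * v x)) x) (u i)"
    unfolding z by (simp add: inner_on_def)
  also have "\<dots> = (\<Sum>j\<in>J. c (u j) * inner_on \<Omega> (u j) (u i))"
    by (simp add: sum_fun_apply inner_on_sum_left inner_on_scale_left sum.reindex[OF inj])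
  also have "\<dots> = (\<Sum>j\<in>J. if j = i then c (u j) else 0)"
    using on J i by (intro sum.cong) (auto simp: orthonormal_on_def subset_iff)
  also have "\<dots> = c v" using finJ i by simp
  finally show False using v(2) by simp
qed

lemma eigenbasis_on_coeff_eq_0:
  assumes sym: "\<forall>x y. A x y = A y x" and eb: "eigenbasis_on \<Omega> A u \<mu> m"
    and f: "\<forall>x\<in>\<Omega>. kernel_op \<Omega> A f x = l * f x" and j: "j < m" "\<mu> j \<noteq> l"
  shows "inner_on \<Omega> f (u j) = 0"
proof -
  have "l * inner_on \<Omega> f (u j) = inner_on \<Omega> (kernel_op \<Omega> A f) (u j)"
    unfolding inner_on_scale_left[symmetric] using f by (intro inner_on_cong) auto
  also have "\<dots> = inner_on \<Omega> f (kernel_op \<Omega> A (u j))" by (rule kernel_op_symmetric[OF sym])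
  also have "\<dots> = \<mu> j * inner_on \<Omega> f (u j)"
    unfolding inner_on_scale_right[symmetric] using eb j(1)
    by (intro inner_on_cong) (auto simp: eigenbasis_on_def)
  finally show ?thesis using j(2) by simp
qed

text \<open>The \<open>u j\<close> with \<open>\<mu> j = l\<close> form a basis: in the expansion of
  an eigenfunction for l all other coefficients vanish, since eigenfunctions for different
  eigenvalues are orthogonal.\<close>

lemma dim_eigenspace:
  assumes fin: "finite \<Omega>" and sym: "\<forall>x y. A x y = A y x"
    and eb: "eigenbasis_on \<Omega> A u \<mu> (card \<Omega>)"
  shows "fun_space.dim {f \<in> functions_on \<Omega>. \<forall>x\<in>\<Omega>. kernel_op \<Omega> A f x = l * f x}
    = card {j. j < card \<Omega> \<and> \<mu> j = l}"
proof (rule fun_space.dim_unique)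
  let ?J = "{j. j < card \<Omega> \<and> \<mu> j = l}"
  let ?E = "{f \<in> functions_on \<Omega>. \<forall>x\<in>\<Omega>. kernel_op \<Omega> A f x = l * f x}"
  have on: "orthonormal_on \<Omega> u (card \<Omega>)" using eb by (simp add: eigenbasis_on_def)
  have J: "?J \<subseteq> {..<card \<Omega>}" by auto
  show "u ` ?J \<subseteq> ?E" using eb by (auto simp: eigenbasis_on_def orthonormal_on_def)
  show "\<not> fun_space.dependent (u ` ?J)" by (rule independent_orthonormal[OF on J])
  show "card (u ` ?J) = card ?J"
    by (rule card_image) (rule inj_on_subset[OF inj_on_orthonormal[OF on] J])
  show "?E \<subseteq> fun_space.span (u ` ?J)"
  proof
    fix f assume f: "f \<in> ?E"
    have "f x = (\<Sum>j\<in>?J. inner_on \<Omega> f (u j) * u j x)" for x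
    proof (cases "x \<in> \<Omega>")
      case True
      have "(\<Sum>j<card \<Omega>. inner_on \<Omega> f (u j) * u j x) = (\<Sum>j\<in>?J. inner_on \<Omega> f (u j) * u j x)"
        using f eigenbasis_on_coeff_eq_0[OF sym eb, of f l]
        by (intro sum.mono_neutral_right) auto
      thus ?thesis using orthonormal_on_expansion[OF fin on True, of f] by simp
    next
      case False
      thus ?thesis using f on by (simp add: functions_on_def orthonormal_on_def)
    qed
    hence "f = (\<Sum>j\<in>?J. (\<lambda>x. inner_on \<Omega> f (u j) * u j x))"
      by (simp add: fun_eq_iff sum_fun_apply)
    also have "\<dots> \<in> fun_space.span (u ` ?J)"
      by (intro fun_space.span_sum fun_space.span_scale fun_space.span_base) auto
    finally show "f \<in> fun_space.span (u ` ?J)" .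
  qed
qed

lemma eigenvalues_eq_image:
  assumes fin: "finite \<Omega>" and sym: "\<forall>x y. A x y = A y x"
    and eb: "eigenbasis_on \<Omega> A u \<mu> (card \<Omega>)"
  shows "{l. \<exists>f\<in>{f \<in> functions_on \<Omega>. \<forall>x\<in>\<Omega>. kernel_op \<Omega> A f x = l * f x}. f \<noteq> (\<lambda>x. 0)}
    = \<mu> ` {..<card \<Omega>}" (is "?S = _")
proof (intro equalityI subsetI)
  have on: "orthonormal_on \<Omega> u (card \<Omega>)" using eb by (simp add: eigenbasis_on_def)
  fix l
  show "l \<in> \<mu> ` {..<card \<Omega>}" if l: "l \<in> ?S"
  proof (rule ccontr)
    \<comment> \<open>If l differs from every \<open>\<mu> j\<close>, an eigenfunction for l has no
      nonzero coefficient at all.\<close>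
    assume nl: "l \<notin> \<mu> ` {..<card \<Omega>}"
    from l obtain f where f: "f \<in> functions_on \<Omega>" "\<forall>x\<in>\<Omega>. kernel_op \<Omega> A f x = l * f x"
      "f \<noteq> (\<lambda>x. 0)" by auto
    have "f x = 0" for x
    proof (cases "x \<in> \<Omega>")
      case True
      have "(\<Sum>j<card \<Omega>. inner_on \<Omega> f (u j) * u j x) = 0"
        using eigenbasis_on_coeff_eq_0[OF sym eb f(2)] nl by (intro sum.neutral) auto
      thus ?thesis using orthonormal_on_expansion[OF fin on True, of f] by simp
    next
      case False
      thus ?thesis using f(1) by (simp add: functions_on_def)
    qed
    thus False using f(3) by auto
  qed
  show "l \<in> ?S" if "l \<in> \<mu> ` {..<card \<Omega>}"
  proof -
    from that obtain j where j: "j < card \<Omega>" "l = \<mu> j" by auto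
    have "u j \<noteq> (\<lambda>x. 0)"
    proof
      assume "u j = (\<lambda>x. 0)"
      moreover have "inner_on \<Omega> (u j) (u j) = 1" using on j by (simp add: orthonormal_on_def)
      ultimately show False by (simp add: inner_on_def)
    qed
    thus ?thesis using eb j by (auto simp: eigenbasis_on_def orthonormal_on_def)
  qed
qed

section \<open>Sorted lists and multiplicities\<close>

lemma sorted_concat_replicate:
  assumes "sorted L"
  shows "sorted (concat (map (\<lambda>a. replicate (d a) a) L))"
  using assms by (induction L) (auto simp: sorted_append)

lemma count_concat_replicate:
  assumes "distinct L"
  shows "count (mset (concat (map (\<lambda>a. replicate (d a) a) L))) b = (if b \<in> set L then d b else 0)"
  using assms by (induction L) auto

lemma count_mset_map_upt: "count (mset (map f [0..<n])) b = card {j. j < n \<and> f j = b}"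
proof (induction n)
  case (Suc n)
  have "{j. j < Suc n \<and> f j = b} = (if f n = b then insert n else id) {j. j < n \<and> f j = b}"
    by (auto simp: less_Suc_eq)
  thus ?case using Suc by simp
qed simp

text \<open>Both lists are sorted and have the same multiset of entries, which determines a sorted
  list.\<close>

lemma sorted_multiplicities_eq_map:
  fixes \<mu> :: "nat \<Rightarrow> 'a::linorder"
  assumes "\<And>i j. j \<le> i \<Longrightarrow> i < N \<Longrightarrow> \<mu> j \<le> \<mu> i"
  shows "concat (map (\<lambda>l. replicate (card {j. j < N \<and> \<mu> j = l}) l)
      (sorted_list_of_set (\<mu> ` {..<N}))) = map \<mu> [0..<N]" (is "?xs = ?ys")
proof -
  have "mset ?ys = mset ?xs"
  proof (rule multiset_eqI)
    fix b
    \<comment> \<open>Off the image of \<mu> the count must agree with the default 0 in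
      \<open>count_concat_replicate\<close>.\<close>
    have "card {j. j < N \<and> \<mu> j = b} = 0" if "b \<notin> \<mu> ` {..<N}" using that by auto
    thus "count (mset ?ys) b = count (mset ?xs) b"
      unfolding count_mset_map_upt by (subst count_concat_replicate) auto
  qed
  moreover have "sorted ?ys" using assms by (auto simp: sorted_iff_nth_mono)
  ultimately have "sort ?xs = ?ys" by (rule properties_for_sort)
  moreover have "sorted ?xs" by (rule sorted_concat_replicate) simp
  ultimately show ?thesis by (simp only: sorted_sort_id)
qed

subsection \<open>The Dirichlet Laplacian on the lattice\<close>

lemma lattice_nbrs_eq_image:
  fixes x :: "int ^ 'n::finite"
  shows "lattice_nbrs x = (\<lambda>i. x + axis i 1) ` UNIV \<union> (\<lambda>i. x - axis i 1) ` UNIV"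
proof (intro equalityI subsetI)
  fix y :: "int ^ 'n" assume "y \<in> lattice_nbrs x"
  hence s: "(\<Sum>i\<in>UNIV. \<bar>x $ i - y $ i\<bar>) = 1" by (simp add: lattice_nbrs_def)
  have "\<exists>i. x $ i - y $ i \<noteq> 0"
  proof (rule ccontr)
    assume "\<not> ?thesis"
    hence "(\<Sum>i\<in>UNIV. \<bar>x $ i - y $ i\<bar>) = 0" by simp
    thus False using s by simp
  qed
  then obtain i where i: "x $ i - y $ i \<noteq> 0" by blast
  have "\<bar>x $ i - y $ i\<bar> + (\<Sum>j\<in>UNIV - {i}. \<bar>x $ j - y $ j\<bar>) = 1"
    using s by (simp add: sum.remove[of UNIV i])
  moreover have "0 \<le> (\<Sum>j\<in>UNIV - {i}. \<bar>x $ j - y $ j\<bar>)" by (simp add: sum_nonneg)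
  \<comment> \<open>A nonzero integer has absolute value at least 1, so coordinate i already uses up
    the whole distance.\<close>
  ultimately have d: "\<bar>x $ i - y $ i\<bar> = 1" "(\<Sum>j\<in>UNIV - {i}. \<bar>x $ j - y $ j\<bar>) = 0"
    using i by linarith+
  have z: "y $ j = x $ j" if "j \<noteq> i" for j
    using d(2) that by (subst (asm) sum_nonneg_eq_0_iff) auto
  have "y = x + axis i 1 \<or> y = x - axis i 1"
  proof (cases "y $ i = x $ i + 1")
    case True
    thus ?thesis using z by (auto simp: vec_eq_iff axis_def)
  next
    case False
    hence "y $ i = x $ i - 1" using d(1) by linarith
    thus ?thesis using z by (auto simp: vec_eq_iff axis_def)
  qed
  thus "y \<in> (\<lambda>i. x + axis i 1) ` UNIV \<union> (\<lambda>i. x - axis i 1) ` UNIV" by auto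
next
  fix y :: "int ^ 'n" assume "y \<in> (\<lambda>i. x + axis i 1) ` UNIV \<union> (\<lambda>i. x - axis i 1) ` UNIV"
  then obtain i where "y = x + axis i 1 \<or> y = x - axis i 1" by auto
  hence "\<bar>x $ j - y $ j\<bar> = (if j = i then 1 else 0)" for j by (auto simp: axis_def)
  thus "y \<in> lattice_nbrs x" by (simp add: lattice_nbrs_def)
qed

lemma sum_lattice_nbrs:
  fixes x :: "int ^ 'n::finite" and F :: "_ \<Rightarrow> 'b::comm_monoid_add"
  shows "sum F (lattice_nbrs x) = (\<Sum>i\<in>UNIV. F (x + axis i 1) + F (x - axis i 1))"
proof -
  have inj: "inj (\<lambda>i. x + axis i 1)" "inj (\<lambda>i. x - axis i 1)"
    by (auto simp: inj_on_def axis_eq_axis)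
  have "axis i (1::int) \<noteq> - axis j 1" for i j :: 'n
    by (auto simp: vec_eq_iff axis_def dest!: spec[of _ i])
  hence "x + axis i 1 \<noteq> x - axis j 1" for i j
    by (metis add_left_cancel diff_conv_add_uminus)
  hence disj: "(\<lambda>i. x + axis i 1) ` UNIV \<inter> (\<lambda>i. x - axis i 1) ` UNIV = {}" by auto
  show ?thesis unfolding lattice_nbrs_eq_image
    by (simp add: sum.union_disjoint disj sum.reindex inj sum.distrib)
qed

lemma finite_lattice_nbrs: "finite (lattice_nbrs x)"
  by (simp add: lattice_nbrs_eq_image)

lemma lattice_degree_eq: "lattice_degree (x :: int ^ 'n::finite) = 2 * CARD('n)"
  using sum_lattice_nbrs[of "\<lambda>_. 1 :: nat" x] by (simp add: lattice_degree_def)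

lemma lattice_nbrs_commute: "y \<in> lattice_nbrs x \<longleftrightarrow> x \<in> lattice_nbrs y"
  by (simp add: lattice_nbrs_def abs_minus_commute)

text \<open>This is the matrix of the negative Laplacian on the whole lattice; the Dirichlet
  condition enters because \<open>kernel_op\<close> sums over \<Omega> only.\<close>

definition dirichlet_kernel :: "int ^ 'n::finite \<Rightarrow> int ^ 'n \<Rightarrow> real" where
  "dirichlet_kernel x y = (if y = x then 1 else 0)
     - (if y \<in> lattice_nbrs x then 1 / (2 * real CARD('n)) else 0)"

lemma dirichlet_kernel_commute: "dirichlet_kernel x y = dirichlet_kernel y x"
  by (simp add: dirichlet_kernel_def lattice_nbrs_commute[of y x])

lemma dirichlet_kernel_self: "dirichlet_kernel x x = 1"
  by (simp add: dirichlet_kernel_def lattice_nbrs_def)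

text \<open>Since f vanishes off \<Omega>, summing over the neighbours inside \<Omega> is the same
  as summing over all neighbours.\<close>

lemma kernel_op_dirichlet_kernel:
  fixes \<Omega> :: "(int ^ 'n::finite) set"
  assumes fin: "finite \<Omega>" and f: "f \<in> functions_on \<Omega>" and x: "x \<in> \<Omega>"
  shows "kernel_op \<Omega> dirichlet_kernel f x
    = f x - (\<Sum>i\<in>UNIV. f (x + axis i 1) + f (x - axis i 1)) / (2 * real CARD('n))"
proof -
  have "(\<Sum>y\<in>\<Omega>. if y \<in> lattice_nbrs x then f y else 0) = (\<Sum>y\<in>\<Omega> \<inter> lattice_nbrs x. f y)"
    using fin by (simp add: sum.inter_restrict)
  also have "\<dots> = sum f (lattice_nbrs x)"
    using f by (intro sum.mono_neutral_left finite_lattice_nbrs) (auto simp: functions_on_def)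
  finally have n: "(\<Sum>y\<in>\<Omega>. if y \<in> lattice_nbrs x then f y else 0) = sum f (lattice_nbrs x)" .
  have "kernel_op \<Omega> dirichlet_kernel f x = (\<Sum>y\<in>\<Omega>. f y * (if y = x then 1 else 0))
     - (\<Sum>y\<in>\<Omega>. if y \<in> lattice_nbrs x then f y else 0) / (2 * real CARD('n))"
    unfolding kernel_op_def sum_divide_distrib sum_subtractf[symmetric]
    by (intro sum.cong) (auto simp: dirichlet_kernel_def algebra_simps)
  thus ?thesis using inner_on_delta_right[OF fin x, of f] n
    by (simp add: inner_on_def sum_lattice_nbrs)
qed

lemma dirichlet_laplacian_eq_kernel_op:
  assumes "finite \<Omega>" "f \<in> functions_on \<Omega>" "x \<in> \<Omega>"
  shows "- dirichlet_laplacian \<Omega> f x = kernel_op \<Omega> dirichlet_kernel f x"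
proof -
  have "extend_zero \<Omega> f = f" using assms(2) by (auto simp: extend_zero_def functions_on_def)
  thus ?thesis using assms(3)
    by (simp add: dirichlet_laplacian_def kernel_op_dirichlet_kernel[OF assms] lattice_laplacian_def
        lattice_degree_eq sum_lattice_nbrs) (simp add: extend_zero_def lattice_laplacian_def
        lattice_degree_eq sum_lattice_nbrs)
qed

lemma dirichlet_eigenspace_eq:
  assumes "finite \<Omega>"
  shows "dirichlet_eigenspace \<Omega> l
    = {f \<in> functions_on \<Omega>. \<forall>x\<in>\<Omega>. kernel_op \<Omega> dirichlet_kernel f x = l * f x}"
  using dirichlet_laplacian_eq_kernel_op[OF assms] by (auto simp: dirichlet_eigenspace_def)

text \<open>Identifies the defined spectrum with the ordered eigenbasis; \<open>Suc\<close> appears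
  because the basis is indexed from 0 and the eigenvalues from 1.\<close>

lemma dirichlet_eigenvalue_eq:
  assumes fin: "finite \<Omega>" and eb: "eigenbasis_on \<Omega> dirichlet_kernel u \<mu> (card \<Omega>)"
    and mono: "\<And>i j. j \<le> i \<Longrightarrow> i < card \<Omega> \<Longrightarrow> \<mu> j \<le> \<mu> i" and i: "i < card \<Omega>"
  shows "dirichlet_eigenvalue \<Omega> (Suc i) = \<mu> i"
proof -
  have sym: "\<forall>x y. dirichlet_kernel x y = dirichlet_kernel y x"
    using dirichlet_kernel_commute by blast
  have "dirichlet_spectrum \<Omega> = map \<mu> [0..<card \<Omega>]"
    unfolding dirichlet_spectrum_def dirichlet_eigenvalues_def dirichlet_eigenspace_eq[OF fin]
      eigenvalues_eq_image[OF fin sym eb] dim_eigenspace[OF fin sym eb]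
    by (rule sorted_multiplicities_eq_map[OF mono])
  thus ?thesis using i by (simp add: dirichlet_eigenvalue_def)
qed

section \<open>Translations and the coordinate commutator\<close>

text \<open>Only edges with both endpoints in \<Omega> contribute. Translation by e matches their
  starting points with their end points.\<close>

lemma sum_shift_support:
  fixes e :: "'a::ab_group_add"
  assumes fin: "finite \<Omega>" and F: "\<And>x. x \<notin> \<Omega> \<or> x + e \<notin> \<Omega> \<Longrightarrow> F x = 0"
  shows "(\<Sum>x\<in>\<Omega>. F (x - e)) = (\<Sum>x\<in>\<Omega>. F x)"
proof -
  have "(\<Sum>x\<in>\<Omega>. F x) = (\<Sum>x\<in>{x\<in>\<Omega>. x + e \<in> \<Omega>}. F x)"
    using fin F by (intro sum.mono_neutral_right) auto
  also have "\<dots> = (\<Sum>x\<in>{x\<in>\<Omega>. x - e \<in> \<Omega>}. F (x - e))"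
    by (rule sum.reindex_bij_witness[of _ "\<lambda>x. x - e" "\<lambda>x. x + e"]) auto
  also have "\<dots> = (\<Sum>x\<in>\<Omega>. F (x - e))"
    using fin F by (intro sum.mono_neutral_left) auto
  finally show ?thesis by simp
qed

lemma sum_shift_product:
  fixes e :: "'a::ab_group_add"
  assumes "finite \<Omega>" "f \<in> functions_on \<Omega>"
  shows "(\<Sum>x\<in>\<Omega>. f (x - e) * f x * h x) = (\<Sum>x\<in>\<Omega>. f x * f (x + e) * h (x + e))"
  using sum_shift_support[of \<Omega> e "\<lambda>x. f x * f (x + e) * h (x + e)"] assms
  by (auto simp: functions_on_def)

text \<open>Only an inequality holds, since the part of f on \<Omega> outside the translate of
  \<Omega> is lost.\<close>

lemma sum_translate_le:
  fixes e :: "'a::ab_group_add"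
  assumes fin: "finite \<Omega>" and f: "f \<in> functions_on \<Omega>"
  shows "(\<Sum>x\<in>\<Omega>. (f (x + e))\<^sup>2) \<le> (\<Sum>x\<in>\<Omega>. (f x)\<^sup>2)"
proof -
  have "(\<Sum>x\<in>\<Omega>. (f (x + e))\<^sup>2) = (\<Sum>x\<in>(\<lambda>x. x + e) ` \<Omega>. (f x)\<^sup>2)"
    by (subst sum.reindex) (auto simp: inj_on_def)
  also have "\<dots> = (\<Sum>x\<in>(\<lambda>x. x + e) ` \<Omega> \<inter> \<Omega>. (f x)\<^sup>2)"
    using fin f by (intro sum.mono_neutral_right) (auto simp: functions_on_def)
  also have "\<dots> \<le> (\<Sum>x\<in>\<Omega>. (f x)\<^sup>2)" using fin by (intro sum_mono2) auto
  finally show ?thesis .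
qed

text \<open>The diagonal part commutes with multiplication. A neighbour y contributes its kernel
  entry times the change of coordinate a from x to y, which is 1 or -1 along axis a and 0 along
  every other axis.\<close>

lemma coordinate_commutator:
  fixes \<Omega> :: "(int ^ 'n::finite) set" and f :: "int ^ 'n \<Rightarrow> real"
  assumes fin: "finite \<Omega>" and f: "f \<in> functions_on \<Omega>" and x: "x \<in> \<Omega>"
  shows "kernel_op \<Omega> dirichlet_kernel (\<lambda>y. of_int (y $ a) * f y) x
      - of_int (x $ a) * kernel_op \<Omega> dirichlet_kernel f x
    = (f (x - axis a 1) - f (x + axis a 1)) / (2 * real CARD('n))"
proof -
  have gf: "(\<lambda>y. of_int (y $ a) * f y) \<in> functions_on \<Omega>"
    using f by (auto simp: functions_on_def)
  define G where
    "G = (\<Sum>i\<in>UNIV. of_int ((x + axis i 1) $ a) * f (x + axis i 1)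
         + of_int ((x - axis i 1) $ a) * f (x - axis i 1))"
  define F where "F = (\<Sum>i\<in>UNIV. f (x + axis i 1) + f (x - axis i 1))"
  have "G - of_int (x $ a) * F
    = (\<Sum>i\<in>UNIV. if i = a then f (x + axis a 1) - f (x - axis a 1) else 0)"
    unfolding G_def F_def sum_distrib_left sum_subtractf[symmetric]
    by (intro sum.cong) (auto simp: axis_def algebra_simps)
  hence "G - of_int (x $ a) * F = f (x + axis a 1) - f (x - axis a 1)" by simp
  thus ?thesis
    unfolding kernel_op_dirichlet_kernel[OF fin gf x] kernel_op_dirichlet_kernel[OF fin f x]
      G_def[symmetric] F_def[symmetric]
    by (simp add: right_diff_distrib diff_divide_distrib[symmetric])
qed

text \<open>Only the pairing of \<open>f\<close> with its positive translate survives, because the two coordinate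
  values differ by one.\<close>

lemma coordinate_commutator_pairing:
  fixes \<Omega> :: "(int ^ 'n::finite) set" and f :: "int ^ 'n \<Rightarrow> real"
  assumes fin: "finite \<Omega>" and f: "f \<in> functions_on \<Omega>"
  shows "inner_on \<Omega> (\<lambda>x. (f (x - axis a 1) - f (x + axis a 1)) / (2 * real CARD('n)))
      (\<lambda>x. of_int (x $ a) * f x)
    = (\<Sum>x\<in>\<Omega>. f x * f (x + axis a 1)) / (2 * real CARD('n))"
proof -
  have "(\<Sum>x\<in>\<Omega>. (f (x - axis a 1) - f (x + axis a 1)) * (of_int (x $ a) * f x))
    = (\<Sum>x\<in>\<Omega>. f (x - axis a 1) * f x * of_int (x $ a))
      - (\<Sum>x\<in>\<Omega>. f x * f (x + axis a 1) * of_int (x $ a))"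
    by (simp add: sum_subtractf[symmetric] algebra_simps)
  also have "(\<Sum>x\<in>\<Omega>. f (x - axis a 1) * f x * of_int (x $ a))
    = (\<Sum>x\<in>\<Omega>. f x * f (x + axis a 1) * of_int ((x + axis a 1) $ a))"
    by (rule sum_shift_product[OF fin f])
  finally have "(\<Sum>x\<in>\<Omega>. (f (x - axis a 1) - f (x + axis a 1)) * (of_int (x $ a) * f x))
    = (\<Sum>x\<in>\<Omega>. f x * f (x + axis a 1))"
    by (simp add: sum_subtractf[symmetric] axis_def algebra_simps)
  thus ?thesis by (simp add: inner_on_def sum_divide_distrib[symmetric])
qed

text \<open>The difference over two steps is split at the midpoint x into two unit differences,
  whose squares lead to the Dirichlet energy of f along axis a.\<close>

lemma coordinate_commutator_norm:
  fixes a :: "'n::finite" and \<Omega> :: "(int ^ 'n) set" and f :: "int ^ 'n \<Rightarrow> real"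
  assumes fin: "finite \<Omega>" and f: "f \<in> functions_on \<Omega>"
  defines "c \<equiv> \<lambda>x. (f (x - axis a 1) - f (x + axis a 1)) / (2 * real CARD('n))"
  shows "inner_on \<Omega> c c
    \<le> 2 * (inner_on \<Omega> f f - (\<Sum>x\<in>\<Omega>. f x * f (x + axis a 1))) / (real CARD('n))\<^sup>2"
proof -
  let ?e = "axis a 1 :: int ^ 'n"
  \<comment> \<open>The right side is 2(p - r)^2 + 2(r - q)^2, and it exceeds the left side by
    exactly (p + q - 2r)^2.\<close>
  have pt: "(p - q)\<^sup>2 \<le> 2 * p\<^sup>2 + 2 * q\<^sup>2 + 4 * r\<^sup>2 - 4 * (p * r) - 4 * (r * q)" for p q r :: real
    using zero_le_power2[of "p + q - 2 * r"] by (simp add: power2_eq_square algebra_simps)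
  have "(\<Sum>x\<in>\<Omega>. (f (x - ?e) - f (x + ?e))\<^sup>2)
    \<le> (\<Sum>x\<in>\<Omega>. 2 * (f (x - ?e))\<^sup>2 + 2 * (f (x + ?e))\<^sup>2 + 4 * (f x)\<^sup>2
        - 4 * (f (x - ?e) * f x) - 4 * (f x * f (x + ?e)))"
    by (intro sum_mono pt)
  also have "\<dots> = 2 * (\<Sum>x\<in>\<Omega>. (f (x - ?e))\<^sup>2) + 2 * (\<Sum>x\<in>\<Omega>. (f (x + ?e))\<^sup>2) + 4 * (\<Sum>x\<in>\<Omega>. (f x)\<^sup>2)
       - 4 * (\<Sum>x\<in>\<Omega>. f (x - ?e) * f x) - 4 * (\<Sum>x\<in>\<Omega>. f x * f (x + ?e))"
    by (simp add: sum.distrib sum_subtractf sum_distrib_left)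
  also have "(\<Sum>x\<in>\<Omega>. f (x - ?e) * f x) = (\<Sum>x\<in>\<Omega>. f x * f (x + ?e))"
    using sum_shift_product[OF fin f, of ?e "\<lambda>_. 1"] by simp
  \<comment> \<open>Both translated square sums are at most that of f, giving 2 + 2 + 4 = 8; the two
    cross sums coincide and also give 8.\<close>
  finally have "(\<Sum>x\<in>\<Omega>. (f (x - ?e) - f (x + ?e))\<^sup>2)
      \<le> 8 * (\<Sum>x\<in>\<Omega>. (f x)\<^sup>2) - 8 * (\<Sum>x\<in>\<Omega>. f x * f (x + ?e))"
    using sum_translate_le[OF fin f, of ?e] sum_translate_le[OF fin f, of "- ?e"] by simp
  hence "(\<Sum>x\<in>\<Omega>. (f (x - ?e) - f (x + ?e))\<^sup>2) / (4 * (real CARD('n))\<^sup>2)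
     \<le> (8 * (\<Sum>x\<in>\<Omega>. (f x)\<^sup>2) - 8 * (\<Sum>x\<in>\<Omega>. f x * f (x + ?e))) / (4 * (real CARD('n))\<^sup>2)"
    by (rule divide_right_mono) simp
  moreover have "inner_on \<Omega> c c = (\<Sum>x\<in>\<Omega>. (f (x - ?e) - f (x + ?e))\<^sup>2) / (4 * (real CARD('n))\<^sup>2)"
    by (simp add: inner_on_def c_def power2_eq_square sum_divide_distrib)
  ultimately show ?thesis by (simp add: inner_on_def power2_eq_square field_simps)
qed

text \<open>The eigenvalue is the quadratic form at the unit vector f, and in it the forward and the
  backward translate along each axis contribute equally.\<close>

lemma sum_translate_products:
  fixes \<Omega> :: "(int ^ 'n::finite) set" and f :: "int ^ 'n \<Rightarrow> real"
  assumes fin: "finite \<Omega>" and f: "f \<in> functions_on \<Omega>" and unit: "inner_on \<Omega> f f = 1"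
    and eig: "\<forall>x\<in>\<Omega>. kernel_op \<Omega> dirichlet_kernel f x = l * f x"
  shows "(\<Sum>a\<in>UNIV. \<Sum>x\<in>\<Omega>. f x * f (x + axis a 1)) = real CARD('n) * (1 - l)"
proof -
  let ?n = "real CARD('n)"
  have "l = inner_on \<Omega> (\<lambda>x. l * f x) f" by (simp add: inner_on_scale_left unit)
  also have "\<dots> = inner_on \<Omega> (\<lambda>x. f x - 1 / (2 * ?n) * (\<Sum>i\<in>UNIV. f (x + axis i 1) + f (x - axis i 1))) f"
    using eig kernel_op_dirichlet_kernel[OF fin f] by (intro inner_on_cong) auto
  also have "\<dots> = 1 - 1 / (2 * ?n) * inner_on \<Omega> (\<lambda>x. \<Sum>i\<in>UNIV. f (x + axis i 1) + f (x - axis i 1)) f"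
    by (simp add: inner_on_diff_left inner_on_scale_left unit del: times_divide_eq_left)
  also have "inner_on \<Omega> (\<lambda>x. \<Sum>i\<in>UNIV. f (x + axis i 1) + f (x - axis i 1)) f
    = (\<Sum>i\<in>UNIV. 2 * (\<Sum>x\<in>\<Omega>. f x * f (x + axis i 1)))"
    unfolding inner_on_sum_left
  proof (rule sum.cong[OF refl])
    fix i
    have "(\<Sum>x\<in>\<Omega>. f (x - axis i 1) * f x) = (\<Sum>x\<in>\<Omega>. f x * f (x + axis i 1))"
      using sum_shift_product[OF fin f, of "axis i 1" "\<lambda>_. 1"] by simp
    thus "inner_on \<Omega> (\<lambda>x. f (x + axis i 1) + f (x - axis i 1)) f
        = 2 * (\<Sum>x\<in>\<Omega>. f x * f (x + axis i 1))"
      unfolding inner_on_add_left by (simp add: inner_on_def mult.commute)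
  qed
  finally show ?thesis by (simp add: sum_distrib_left[symmetric] field_simps)
qed

section \<open>The gap estimate\<close>

text \<open>Summing over the axes gives half of each 1 - \<open>\<mu> i\<close> on the left and 2/n
  times \<open>\<mu> i\<close> on the right, whence the constant 4/n. In product form the sign of
  the later denominator does not matter yet.\<close>

lemma dirichlet_gap_inequality:
  fixes \<Omega> :: "(int ^ 'n::finite) set"
  assumes fin: "finite \<Omega>" and eb: "eigenbasis_on \<Omega> dirichlet_kernel u \<mu> (card \<Omega>)"
    and mono: "\<And>i j. j \<le> i \<Longrightarrow> i < card \<Omega> \<Longrightarrow> \<mu> j \<le> \<mu> i" and k: "1 \<le> k" "k < card \<Omega>"
  shows "(\<mu> k - \<mu> (k - 1)) * (\<Sum>i<k. 1 - \<mu> i) \<le> 4 / real CARD('n) * (\<Sum>i<k. \<mu> i)"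
proof -
  let ?n = "real CARD('n)"
  have sym: "\<forall>x y. dirichlet_kernel x y = dirichlet_kernel (y :: int ^ 'n) x"
    using dirichlet_kernel_commute by blast
  have u: "u i \<in> functions_on \<Omega>" "inner_on \<Omega> (u i) (u i) = 1"
    "\<forall>x\<in>\<Omega>. kernel_op \<Omega> dirichlet_kernel (u i) x = \<mu> i * u i x" if "i < k" for i
    using eb that k by (auto simp: eigenbasis_on_def orthonormal_on_def)
  let ?S = "\<lambda>a i. \<Sum>x\<in>\<Omega>. u i x * u i (x + axis a 1)"
  have S: "(\<Sum>a\<in>UNIV. ?S a i) = ?n * (1 - \<mu> i)" if "i < k" for i
    using sum_translate_products[OF fin u(1,2,3)] that by blast
  have main: "(\<mu> k - \<mu> (k - 1)) * (\<Sum>i<k. ?S a i / (2 * ?n)) \<le> (\<Sum>i<k. 2 * (1 - ?S a i) / ?n\<^sup>2)"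
    for a :: 'n
  proof -
    let ?g = "\<lambda>x :: int ^ 'n. real_of_int (x $ a)"
    let ?C = "\<lambda>i x. kernel_op \<Omega> dirichlet_kernel (\<lambda>y. ?g y * u i y) x
      - ?g x * kernel_op \<Omega> dirichlet_kernel (u i) x"
    let ?c = "\<lambda>i x. (u i (x - axis a 1) - u i (x + axis a 1)) / (2 * ?n)"
    \<comment> \<open>The explicit commutator formula holds on \<Omega>, and \<open>inner_on\<close>
      sees nothing else.\<close>
    have C: "inner_on \<Omega> (?C i) h = inner_on \<Omega> (?c i) h" if "i < k" for i h
      using coordinate_commutator[OF fin u(1)[OF that]] by (intro inner_on_cong) auto
    have "(\<mu> k - \<mu> (k - 1)) * (\<Sum>i<k. ?S a i / (2 * ?n))
      = (\<mu> k - \<mu> (k - 1)) * (\<Sum>i<k. inner_on \<Omega> (?C i) (\<lambda>x. ?g x * u i x))"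
      using C coordinate_commutator_pairing[OF fin u(1), of _ a] by simp
    also have "\<dots> \<le> (\<Sum>i<k. inner_on \<Omega> (?C i) (?C i))"
      by (rule commutator_gap_inequality[OF fin sym eb mono k])
    also have "\<dots> = (\<Sum>i<k. inner_on \<Omega> (?c i) (?c i))"
    proof (rule sum.cong[OF refl])
      fix i assume "i \<in> {..<k}"
      hence "i < k" by simp
      from C[OF this] show "inner_on \<Omega> (?C i) (?C i) = inner_on \<Omega> (?c i) (?c i)"
        by (simp add: inner_on_commute[of \<Omega> "?c i" "?C i"])
    qed
    also have "\<dots> \<le> (\<Sum>i<k. 2 * (1 - ?S a i) / ?n\<^sup>2)"
      using coordinate_commutator_norm[OF fin u(1), of _ a] u(2) by (intro sum_mono) fastforce
    finally show ?thesis .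
  qed
  have "(\<Sum>a\<in>UNIV. (\<mu> k - \<mu> (k - 1)) * (\<Sum>i<k. ?S a i / (2 * ?n)))
    \<le> (\<Sum>a\<in>UNIV. \<Sum>i<k. 2 * (1 - ?S a i) / ?n\<^sup>2)"
    by (intro sum_mono main)
  moreover have "(\<Sum>a\<in>UNIV. (\<mu> k - \<mu> (k - 1)) * (\<Sum>i<k. ?S a i / (2 * ?n)))
    = (\<mu> k - \<mu> (k - 1)) * (\<Sum>i<k. (\<Sum>a\<in>UNIV. ?S a i) / (2 * ?n))"
    unfolding sum_distrib_left[symmetric] by (subst sum.swap) (simp add: sum_divide_distrib)
  moreover have "(\<Sum>a\<in>UNIV. \<Sum>i<k. 2 * (1 - ?S a i) / ?n\<^sup>2)
    = (\<Sum>i<k. 2 * (?n - (\<Sum>a\<in>UNIV. ?S a i)) / ?n\<^sup>2)"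
    by (subst sum.swap) (simp add: sum_divide_distrib[symmetric] sum_distrib_left[symmetric] sum_subtractf)
  moreover have "(\<Sum>i<k. (\<Sum>a\<in>UNIV. ?S a i) / (2 * ?n)) = (\<Sum>i<k. 1 - \<mu> i) / 2"
    by (subst (2) sum_divide_distrib) (intro sum.cong, auto simp: S)
  moreover have "(\<Sum>i<k. 2 * (?n - (\<Sum>a\<in>UNIV. ?S a i)) / ?n\<^sup>2) = 2 / ?n * (\<Sum>i<k. \<mu> i)"
    unfolding sum_distrib_left[of "2 / ?n"]
  proof (rule sum.cong[OF refl])
    fix i assume "i \<in> {..<k}"
    hence "?n - (\<Sum>a\<in>UNIV. ?S a i) = ?n * \<mu> i" using S[of i] by (simp add: right_diff_distrib)
    thus "2 * (?n - (\<Sum>a\<in>UNIV. ?S a i)) / ?n\<^sup>2 = 2 / ?n * \<mu> i"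
      by (simp only:) (simp add: power2_eq_square)
  qed
  ultimately show ?thesis by simp
qed

text \<open>The eigenvalues average to 1 over the whole spectrum, since the operator has diagonal
  entries 1; the average over the smallest ones is therefore at most 1.\<close>

lemma sum_one_minus_nonneg:
  assumes fin: "finite \<Omega>" and eb: "eigenbasis_on \<Omega> dirichlet_kernel u \<mu> (card \<Omega>)"
    and mono: "\<And>i j. j \<le> i \<Longrightarrow> i < card \<Omega> \<Longrightarrow> \<mu> j \<le> \<mu> i" and k: "k \<le> card \<Omega>"
  shows "0 \<le> (\<Sum>i<k. 1 - \<mu> i)"
proof (rule ccontr)
  assume neg: "\<not> ?thesis"
  have "\<exists>i<k. \<mu> i > 1"
  proof (rule ccontr)
    assume "\<not> ?thesis"
    hence "0 \<le> (\<Sum>i<k. 1 - \<mu> i)" by (intro sum_nonneg) auto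
    thus False using neg by simp
  qed
  \<comment> \<open>From index k on all eigenvalues are at least \<open>\<mu> i\<close> > 1, so the
    tail cannot compensate a negative head, although the total is 0.\<close>
  then obtain i where i: "i < k" "\<mu> i > 1" by auto
  have "(\<Sum>j\<in>{k..<card \<Omega>}. 1 - \<mu> j) \<le> 0"
  proof (intro sum_nonpos)
    fix j assume "j \<in> {k..<card \<Omega>}"
    hence "\<mu> i \<le> \<mu> j" using i by (intro mono) auto
    thus "1 - \<mu> j \<le> 0" using i by simp
  qed
  moreover have "(\<Sum>j<card \<Omega>. 1 - \<mu> j) = (\<Sum>j<k. 1 - \<mu> j) + (\<Sum>j\<in>{k..<card \<Omega>}. 1 - \<mu> j)"
    using k by (simp add: lessThan_atLeast0 sum.atLeastLessThan_concat)
  moreover have "(\<Sum>j<card \<Omega>. 1 - \<mu> j) = 0"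
    using eigenbasis_on_trace[OF fin eb] by (simp add: sum_subtractf dirichlet_kernel_self)
  ultimately show False using neg by linarith
qed

theorem theorem1p1:
  fixes \<Omega> :: "(int ^ 'n::finite) set" and k :: nat
  assumes "finite \<Omega>"
    and "1 \<le> k" and "k \<le> card \<Omega> - 1"
  shows "ereal (dirichlet_eigenvalue \<Omega> (k + 1) - dirichlet_eigenvalue \<Omega> k)
    \<le> (if (\<Sum>i=1..k. 1 - dirichlet_eigenvalue \<Omega> i) = 0 then \<infinity>
        else ereal (4 / real CARD('n)
               * ((\<Sum>i=1..k. dirichlet_eigenvalue \<Omega> i)
                  / (\<Sum>i=1..k. 1 - dirichlet_eigenvalue \<Omega> i))))"
proof -
  \<comment> \<open>As k is at least 1, the truncated subtraction in
    \<open>card \<Omega> - 1\<close> does no harm.\<close>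
  have k: "k < card \<Omega>" using assms(2,3) by simp
  have sym: "\<forall>x y. dirichlet_kernel x y = dirichlet_kernel (y :: int ^ 'n) x"
    using dirichlet_kernel_commute by blast
  obtain u \<mu> where eb: "eigenbasis_on \<Omega> dirichlet_kernel u \<mu> (card \<Omega>)"
    and "\<forall>i<card \<Omega>. \<forall>j\<le>i. \<mu> j \<le> \<mu> i"
    by (rule eigenbasis_on_exists[OF assms(1) sym])
  hence mono: "\<And>i j. j \<le> i \<Longrightarrow> i < card \<Omega> \<Longrightarrow> \<mu> j \<le> \<mu> i" by blast
  have ev: "dirichlet_eigenvalue \<Omega> (Suc i) = \<mu> i" if "i < card \<Omega>" for i
    by (rule dirichlet_eigenvalue_eq[OF assms(1) eb mono that])
  have shift: "(\<Sum>i=1..k. F (dirichlet_eigenvalue \<Omega> i)) = (\<Sum>i<k. F (\<mu> i))" for F :: "real \<Rightarrow> real"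
  proof -
    have "(\<Sum>i=1..k. F (dirichlet_eigenvalue \<Omega> i)) = (\<Sum>i<k. F (dirichlet_eigenvalue \<Omega> (Suc i)))"
      by (rule sum.reindex_bij_witness[of _ Suc "\<lambda>i. i - 1"]) auto
    also have "\<dots> = (\<Sum>i<k. F (\<mu> i))" using k ev by (intro sum.cong) auto
    finally show ?thesis .
  qed
  let ?s = "\<Sum>i<k. 1 - \<mu> i"
  \<comment> \<open>With indices from 0, \<open>\<mu> k\<close> is eigenvalue k + 1 and
    \<open>\<mu> (k - 1)\<close> is eigenvalue k.\<close>
  have gap: "dirichlet_eigenvalue \<Omega> (k + 1) - dirichlet_eigenvalue \<Omega> k = \<mu> k - \<mu> (k - 1)"
    using ev[of k] ev[of "k - 1"] k assms(2) by simp
  have "\<mu> k - \<mu> (k - 1) \<le> 4 / real CARD('n) * ((\<Sum>i<k. \<mu> i) / ?s)" if "?s \<noteq> 0"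
  proof -
    \<comment> \<open>A nonzero denominator is positive by the trace argument, so dividing preserves
      the inequality.\<close>
    have "0 < ?s" using sum_one_minus_nonneg[OF assms(1) eb mono, of k] k that by simp
    thus ?thesis
      using dirichlet_gap_inequality[OF assms(1) eb mono assms(2) k] by (simp add: pos_le_divide_eq mult_ac)
  qed
  thus ?thesis using shift[of "\<lambda>t. 1 - t"] shift[of "\<lambda>t. t"] gap by simp
qed

end
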